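(* Let $b\ge 1$ be an integer such that there exists a Hadamard matrix of order $4b$. Then for all integers $\alpha, k$ with $\alpha\geq 2$ and $2^{\alpha}+\alpha+1\leq k<2^{\alpha}b-\alpha$ there exists an array of type $I_{k+\alpha}(2^{\alpha}b,2^k,2,2)$.
   Context: For an integer $s\ge 1$ let $[s]=\{0,1,\dots,s-1\}$. An orthogonal array OA$(n,k,q,t)$ (size $n$, degree $k$, $q$ levels, strength $t$, $1\le t\leq k$) is an $n\times k$ array with entries from $[q]$ such that in every $n\times t$ submatrix (choice of $t$ columns), every vector of $[q]^t$ appears as a row exactly $n/q^t$ times. An array of type $I_k(m,n,q,t)$ (an $m\times n$ row-column factorial design $q^k$ of strength $t$) is an $m\times n$ array whose cells each contain a vector of $[q]^k$ such that: (i) each vector of $[q]^k$ occurs in exactly $\lambda=mn/q^k$ cells (so $q^k\mid mn$); (ii) for each row of the array, the $n$ vectors in that row are the rows of an OA$(n,k,q,t)$; (iii) for each column of the array, the $m$ vectors in that column are the rows of an OA$(m,k,q,t)$. A Hadamard matrix of order $n$ is an $n\times n$ matrix $H$ with entries in $\{1,-1\}$ and $HH^T=nI_n$. *)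

theory Defs
  imports "Jordan_Normal_Form.Matrix" "Jordan_Normal_Form.DL_Submatrix"
begin

definition level_vecs :: "nat \<Rightarrow> nat \<Rightarrow> nat vec set" where
  "level_vecs q k = {v \<in> carrier_vec k. set\<^sub>v v \<subseteq> {..<q}}"

(* The factor q ^ t is kept on the left of the counting equation, so that the condition
   "exactly n / q ^ t times" is not affected by truncated division on nat. *)
definition orthogonal_array :: "nat \<Rightarrow> nat \<Rightarrow> nat \<Rightarrow> nat \<Rightarrow> nat mat \<Rightarrow> bool" where
  "orthogonal_array n k q t A \<longleftrightarrow>
     1 \<le> q \<and> 1 \<le> t \<and> t \<le> k \<and>
     A \<in> carrier_mat n k \<and> elements_mat A \<subseteq> {..<q} \<and>
     (\<forall>C. C \<subseteq> {..<k} \<and> card C = t \<longrightarrow>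
        (\<forall>w \<in> level_vecs q t.
           card {i. i < n \<and> row (submatrix A UNIV C) i = w} * q ^ t = n))"

(* An m x n array whose cells contain vectors is a matrix D over the type nat vec, so that
   row D i and col D j are vectors of vectors. Their entries, listed in order, are made the
   rows of an n x k (resp. m x k) matrix; the order does not matter for orthogonal arrays.
   Since the counting equation holds for every v, it contains q ^ k dvd m * n. *)
definition row_column_design ::
    "nat \<Rightarrow> nat \<Rightarrow> nat \<Rightarrow> nat \<Rightarrow> nat \<Rightarrow> nat vec mat \<Rightarrow> bool" where
  "row_column_design k m n q t D \<longleftrightarrow>
     1 \<le> q \<and> 1 \<le> t \<and> t \<le> k \<and>
     D \<in> carrier_mat m n \<and> elements_mat D \<subseteq> level_vecs q k \<and>
     (\<forall>v \<in> level_vecs q k.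
        card {(i, j). i < m \<and> j < n \<and> D $$ (i, j) = v} * q ^ k = m * n) \<and>
     (\<forall>i < m. orthogonal_array n k q t (mat_of_rows k (list_of_vec (row D i)))) \<and>
     (\<forall>j < n. orthogonal_array m k q t (mat_of_rows k (list_of_vec (col D j))))"

definition hadamard_matrix :: "nat \<Rightarrow> int mat \<Rightarrow> bool" where
  "hadamard_matrix n H \<longleftrightarrow>
     H \<in> carrier_mat n n \<and> elements_mat H \<subseteq> {1, -1} \<and>
     H * transpose_mat H = int n \<cdot>\<^sub>m 1\<^sub>m n"

end

theory Submission
  imports Defs
begin

text \<open>Write vectors as sets of coordinates. From the Hadamard matrix one obtains an orthogonal array
  \<open>R\<close> with \<open>2 ^ \<alpha> * b\<close> rows whose last \<open>\<alpha>\<close> coordinates jointly take every value \<open>b\<close> times. Let \<open>g\<close> be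
  a linear map from the subsets \<open>x\<close> of the first \<open>k\<close> coordinates to subsets of the last \<open>\<alpha>\<close> ones, such that every
  nontrivial combination of its components involves at least three coordinates, and for each value
  \<open>v\<close> let \<open>\<rho> v\<close> permute the rows of \<open>R\<close> so as to translate their last \<open>\<alpha>\<close> coordinates by \<open>v\<close>.
  The design has the entry \<open>x + R (\<rho> (g x) i)\<close> in row \<open>i\<close> and column \<open>x\<close>. Its columns are translates
  of \<open>R\<close>, up to the order of the rows; its rows have strength 2 because \<open>g x\<close> is independent of
  any two coordinates of \<open>x\<close>; and a vector is hit once for each of the \<open>b\<close> rows of \<open>R\<close> that share
  its last \<open>\<alpha>\<close> coordinates.\<close>

section \<open>Strength-2 families of sets and binary orthogonal arrays\<close>

text \<open>Rows are encoded by their supports, so that adding vectors becomes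
  \<open>sym_diff\<close>. The index type stays free because a row of the design is naturally
  indexed by subsets of \<open>{..<k}\<close>.\<close>

definition strength2 :: "'i set \<Rightarrow> nat \<Rightarrow> ('i \<Rightarrow> nat set) \<Rightarrow> bool" where
  "strength2 I N S \<longleftrightarrow> (\<forall>a<N. \<forall>c<N. a \<noteq> c \<longrightarrow>
     (\<forall>p q. 4 * card {i \<in> I. (a \<in> S i) = p \<and> (c \<in> S i) = q} = card I))"

definition bit_vec :: "nat \<Rightarrow> nat set \<Rightarrow> nat vec" where
  "bit_vec N S = vec N (\<lambda>t. of_bool (t \<in> S))"

lemma bit_vec_dim [simp]: "dim_vec (bit_vec N S) = N"
  and bit_vec_carrier [simp]: "bit_vec N S \<in> carrier_vec N"
  and bit_vec_index [simp]: "t < N \<Longrightarrow> bit_vec N S $ t = of_bool (t \<in> S)"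
  by (auto simp: bit_vec_def)

lemma bit_vec_in_level_vecs [simp]: "bit_vec N S \<in> level_vecs 2 N"
  by (auto simp: level_vecs_def vec_set_def)

lemma bit_vec_eq_iff:
  assumes "S \<subseteq> {..<N}" "T \<subseteq> {..<N}"
  shows "bit_vec N S = bit_vec N T \<longleftrightarrow> S = T"
proof
  assume "bit_vec N S = bit_vec N T"
  then have "t \<in> S \<longleftrightarrow> t \<in> T" if "t < N" for t
    using that by (metis bit_vec_index of_bool_eq_iff)
  then show "S = T" using assms by blast
qed simp

lemma level_vecs_2E:
  assumes "v \<in> level_vecs 2 N"
  obtains S where "S \<subseteq> {..<N}" "v = bit_vec N S"
proof
  let ?S = "{t. t < N \<and> v $ t = 1}"
  show "?S \<subseteq> {..<N}" by auto
  have dim: "dim_vec v = N" and "\<And>t. t < N \<Longrightarrow> v $ t < 2"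
    using assms unfolding level_vecs_def vec_set_def by fastforce+
  then have "v $ t = 0 \<or> v $ t = 1" if "t < N" for t
    using that by (metis less_2_cases One_nat_def)
  then show "v = bit_vec N ?S"
    using dim by (intro eq_vecI) force+
qed

lemma pick_two:
  fixes a c :: nat
  assumes "a < c"
  shows "pick {a, c} 0 = a" "pick {a, c} (Suc 0) = c"
proof -
  show a: "pick {a, c} 0 = a"
    unfolding pick.simps by (rule Least_equality) (use assms in auto)
  show "pick {a, c} (Suc 0) = c"
    unfolding pick.simps(2) a by (rule Least_equality) (use assms in auto)
qed

lemma strength2_orthogonal_array:
  assumes S: "strength2 {..<n} N S" and N: "2 \<le> N"
  shows "orthogonal_array n N 2 2 (mat n N (\<lambda>(i, t). of_bool (t \<in> S i)))"
    (is "orthogonal_array n N 2 2 ?A")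
  unfolding orthogonal_array_def
proof (intro conjI allI impI ballI)
  show "elements_mat ?A \<subseteq> {..<2}"
    by (auto simp: elements_mat_def)
  fix C :: "nat set" and w
  assume "C \<subseteq> {..<N} \<and> card C = 2" and w: "w \<in> level_vecs 2 2"
  then have "\<exists>a c. C = {a, c} \<and> a < c"
    by (metis card_2_iff insert_commute linorder_neqE_nat)
  then obtain a c where C: "C = {a, c}" "a < c" by blast
  with \<open>C \<subseteq> {..<N} \<and> card C = 2\<close> have ac: "a < N" "c < N" by auto
  obtain T where w: "w = bit_vec 2 T" using w by (rule level_vecs_2E)
  \<comment> \<open>This set gives the column count of the submatrix, in the form in which
    \<open>submatrix\<close> unfolds.\<close>
  have dims: "card {j. j < N \<and> (j = a \<or> j = c)} = 2"
  proof -
    have "{j. j < N \<and> (j = a \<or> j = c)} = {a, c}" using ac by auto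
    then show ?thesis using C by simp
  qed
  have "row (submatrix ?A UNIV C) i = w \<longleftrightarrow> (a \<in> S i) = (0 \<in> T) \<and> (c \<in> S i) = (1 \<in> T)"
    if "i < n" for i
  proof -
    have "row (submatrix ?A UNIV C) i = bit_vec 2 {t. pick C t \<in> S i}"
      using that ac C dims
      by (intro eq_vecI)
         (auto simp: submatrix_def pick_UNIV less_2_cases_iff pick_two simp del: pick.simps)
    then show ?thesis
      unfolding w vec_eq_iff using C by (auto simp: less_2_cases_iff pick_two simp del: pick.simps)
  qed
  then have "{i. i < n \<and> row (submatrix ?A UNIV C) i = w} =
      {i \<in> {..<n}. (a \<in> S i) = (0 \<in> T) \<and> (c \<in> S i) = (1 \<in> T)}"
    by auto
  then show "card {i. i < n \<and> row (submatrix ?A UNIV C) i = w} * 2 ^ 2 = n"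
    using S ac C by (simp add: strength2_def mult.commute)
qed (use N in auto)

lemma strength2_reindex:
  assumes "strength2 I N S" "bij_betw \<phi> J I"
  shows "strength2 J N (\<lambda>j. S (\<phi> j))"
  unfolding strength2_def
proof (intro allI impI)
  fix a c p q assume ac: "a < N" "c < N" "a \<noteq> c"
  have "bij_betw \<phi> {j \<in> J. (a \<in> S (\<phi> j)) = p \<and> (c \<in> S (\<phi> j)) = q}
      {i \<in> I. (a \<in> S i) = p \<and> (c \<in> S i) = q}"
    using assms(2) by (rule bij_betw_Collect) simp
  from bij_betw_same_card [OF this] bij_betw_same_card [OF assms(2)]
  show "4 * card {j \<in> J. (a \<in> S (\<phi> j)) = p \<and> (c \<in> S (\<phi> j)) = q} = card J"
    using assms(1) ac unfolding strength2_def by simp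
qed

text \<open>Translation by \<open>T\<close> permutes the four patterns at two coordinates, so equal
  counts stay equal.\<close>

lemma strength2_sym_diff:
  assumes "strength2 I N S"
  shows "strength2 I N (\<lambda>i. sym_diff T (S i))"
  unfolding strength2_def
proof (intro allI impI)
  fix a c p q assume ac: "a < N" "c < N" "a \<noteq> c"
  have "{i \<in> I. (a \<in> sym_diff T (S i)) = p \<and> (c \<in> sym_diff T (S i)) = q} =
    {i \<in> I. (a \<in> S i) = (p \<noteq> (a \<in> T)) \<and> (c \<in> S i) = (q \<noteq> (c \<in> T))}"
    by auto
  then show "4 * card {i \<in> I. (a \<in> sym_diff T (S i)) = p \<and> (c \<in> sym_diff T (S i)) = q} = card I"
    using assms ac unfolding strength2_def by simp
qed

text \<open>\<open>\<phi>\<close> pairs the two values of \<open>P\<close> within each class of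
  \<open>Q\<close>, and \<open>\<psi>\<close> balances the two classes of \<open>Q\<close>; hence
  all four counts agree. Since \<open>\<psi>\<close> may disturb \<open>P\<close>, it has to control
  one coordinate only.\<close>

lemma card_quarter_by_flips:
  assumes "finite I"
    and \<phi>: "bij_betw \<phi> I I" "\<And>i. i \<in> I \<Longrightarrow> P (\<phi> i) = (\<not> P i)" "\<And>i. i \<in> I \<Longrightarrow> Q (\<phi> i) = Q i"
    and \<psi>: "bij_betw \<psi> I I" "\<And>i. i \<in> I \<Longrightarrow> Q (\<psi> i) = (\<not> Q i)"
  shows "4 * card {i \<in> I. P i = p \<and> Q i = q} = card I"
proof -
  define M where "M p q = card {i \<in> I. P i = p \<and> Q i = q}" for p q
  have "bij_betw \<phi> {i \<in> I. P i = p \<and> Q i = q} {i \<in> I. P i = (\<not> p) \<and> Q i = q}" for p q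
    using \<phi>(1) by (rule bij_betw_Collect) (auto simp: \<phi>)
  then have M1: "M p q = M (\<not> p) q" for p q
    unfolding M_def by (rule bij_betw_same_card)
  have "bij_betw \<psi> {i \<in> I. Q i} {i \<in> I. \<not> Q i}"
    using \<psi>(1) by (rule bij_betw_Collect) (simp add: \<psi>)
  then have Q: "card {i \<in> I. Q i} = card {i \<in> I. \<not> Q i}"
    by (rule bij_betw_same_card)
  have rows: "card {i \<in> I. Q i = q} = M True q + M False q" for q
    unfolding M_def using \<open>finite I\<close>
    by (subst card_Un_disjoint [symmetric]) (auto intro: arg_cong [where f = card])
  have M2: "M True True + M False True = M True False + M False False"
    using Q rows [of True] rows [of False] by simp
  have "card I = card {i \<in> I. Q i} + card {i \<in> I. \<not> Q i}"
    using \<open>finite I\<close> by (subst card_Un_disjoint [symmetric]) (auto intro: arg_cong [where f = card])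
  with M1 [of True True] M1 [of True False] M2 Q rows [of True]
  have "4 * M p q = card I"
    by (cases p; cases q) auto
  then show ?thesis by (simp add: M_def)
qed

section \<open>The parity map and the strength of twisted cosets\<close>

text \<open>A translation-covariant parity map: each generator of \<open>Pow {k..<k + \<alpha>}\<close> is the parity of
  three coordinates of its own, so that any two coordinates of \<open>x\<close> stay free once the value of the
  map is prescribed. (A chain of two equivalences of three Booleans is their sum modulo 2.)\<close>

definition triple_parity :: "nat \<Rightarrow> nat \<Rightarrow> nat set \<Rightarrow> nat set" where
  "triple_parity k \<alpha> x =
     {k + t | t. t < \<alpha> \<and> ((3 * t \<in> x) \<longleftrightarrow> ((3 * t + 1 \<in> x) \<longleftrightarrow> (3 * t + 2 \<in> x)))}"

lemma triple_parity_cong: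
  assumes "\<And>t. t < \<alpha> \<Longrightarrow>
    ((3 * t \<in> x) \<longleftrightarrow> ((3 * t + 1 \<in> x) \<longleftrightarrow> (3 * t + 2 \<in> x))) =
    ((3 * t \<in> y) \<longleftrightarrow> ((3 * t + 1 \<in> y) \<longleftrightarrow> (3 * t + 2 \<in> y)))"
  shows "triple_parity k \<alpha> x = triple_parity k \<alpha> y"
  using assms unfolding triple_parity_def by blast

lemma triple_parity_subset: "triple_parity k \<alpha> x \<subseteq> {k..<k + \<alpha>}"
  by (auto simp: triple_parity_def)

text \<open>The parity of a triple survives flipping two of its members, so \<open>a\<close> is
  flipped together with a partner from its triple; of the two candidates at least one is not
  \<open>c\<close>. A coordinate beyond the triples is flipped alone.\<close>

lemma triple_parity_flip:
  assumes "a < k" "c \<noteq> a" "3 * \<alpha> \<le> k"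
  obtains d where "d \<subseteq> {..<k}" "a \<in> d" "c \<notin> d"
    "\<And>x. triple_parity k \<alpha> (sym_diff x d) = triple_parity k \<alpha> x"
proof (cases "a < 3 * \<alpha>")
  case False
  have "triple_parity k \<alpha> (sym_diff x {a}) = triple_parity k \<alpha> x" for x
  proof (rule triple_parity_cong)
    fix t assume "t < \<alpha>"
    with False have "3 * t \<noteq> a" "3 * t + 1 \<noteq> a" "3 * t + 2 \<noteq> a" by auto
    then show "((3 * t \<in> sym_diff x {a}) \<longleftrightarrow>
        ((3 * t + 1 \<in> sym_diff x {a}) \<longleftrightarrow> (3 * t + 2 \<in> sym_diff x {a}))) \<longleftrightarrow>
      ((3 * t \<in> x) \<longleftrightarrow> ((3 * t + 1 \<in> x) \<longleftrightarrow> (3 * t + 2 \<in> x)))"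
      by simp
  qed
  with assms show ?thesis by (intro that [of "{a}"]) auto
next
  case True
  define t where "t = a div 3"
  have t: "t < \<alpha>" using True by (simp add: t_def)
  have "\<exists>e \<in> {3 * t, 3 * t + 1, 3 * t + 2}. e \<noteq> a \<and> e \<noteq> c" by auto
  then obtain e where e: "e \<in> {3 * t, 3 * t + 1, 3 * t + 2}" "e \<noteq> a" "e \<noteq> c" by blast
  have a: "a \<in> {3 * t, 3 * t + 1, 3 * t + 2}" unfolding t_def by auto
  \<comment> \<open>Division by 3 is unique, so only triple \<open>t\<close> meets
    \<open>{a, e}\<close>, in exactly two places.\<close>
  have "3 * s \<in> {a, e} \<longleftrightarrow> s = t \<and> (a = 3 * t \<or> e = 3 * t)"
    "3 * s + 1 \<in> {a, e} \<longleftrightarrow> s = t \<and> (a = 3 * t + 1 \<or> e = 3 * t + 1)"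
    "3 * s + 2 \<in> {a, e} \<longleftrightarrow> s = t \<and> (a = 3 * t + 2 \<or> e = 3 * t + 2)" for s
    using a e(1) by auto presburger+
  note mem = this
  show ?thesis
  proof (rule that [of "{a, e}"])
    show "{a, e} \<subseteq> {..<k}" using a e t assms by auto
    show "triple_parity k \<alpha> (sym_diff x {a, e}) = triple_parity k \<alpha> x" for x
    proof (rule triple_parity_cong)
      show "((3 * s \<in> sym_diff x {a, e}) \<longleftrightarrow>
          ((3 * s + 1 \<in> sym_diff x {a, e}) \<longleftrightarrow> (3 * s + 2 \<in> sym_diff x {a, e}))) \<longleftrightarrow>
        ((3 * s \<in> x) \<longleftrightarrow> ((3 * s + 1 \<in> x) \<longleftrightarrow> (3 * s + 2 \<in> x)))" for s
        unfolding Un_iff Diff_iff mem using a e(1,2) by (cases "s = t") auto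
    qed
  qed (use assms e in auto)
qed

text \<open>A single member of a triple switches its generator alone, so high coordinates can be
  flipped one at a time.\<close>

lemma triple_parity_generator:
  assumes "t < \<alpha>"
  shows "triple_parity k \<alpha> (sym_diff x {3 * t}) = sym_diff (triple_parity k \<alpha> x) {k + t}"
proof -
  have "3 * s \<noteq> Suc (3 * t)" "Suc (3 * s) \<noteq> 3 * t" "Suc (Suc (3 * s)) \<noteq> 3 * t" for s
    by presburger+
  then show ?thesis using assms by (auto simp: triple_parity_def)
qed

lemma bij_betw_sym_diff_Pow:
  assumes "d \<subseteq> A"
  shows "bij_betw (\<lambda>x. sym_diff x d) (Pow A) (Pow A)"
  by (rule bij_betw_byWitness [where f' = "\<lambda>x. sym_diff x d"]) (use assms in auto)

text \<open>This gives the strength of the rows of the design. The high part is \<open>y\<close>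
  translated by the parity map, so generators flip high coordinates; a flip that fixes the parity
  map also fixes the vector chosen by \<open>u\<close>, so it acts as a plain translation.\<close>

lemma strength2_twisted_coset:
  assumes k: "3 * \<alpha> \<le> k"
    and Y: "\<And>v. v \<subseteq> {k..<k + \<alpha>} \<Longrightarrow> u v \<inter> {k..<k + \<alpha>} = sym_diff y v"
  shows "strength2 (Pow {..<k}) (k + \<alpha>) (\<lambda>x. sym_diff x (u (triple_parity k \<alpha> x)))"
proof -
  let ?g = "triple_parity k \<alpha>"
  define S where "S x = sym_diff x (u (?g x))" for x
  have fin: "finite (Pow {..<k})" by simp
  have high: "c \<in> S x \<longleftrightarrow> (c \<in> y) \<noteq> (c \<in> ?g x)" if "c \<in> {k..<k + \<alpha>}" "x \<in> Pow {..<k}" for c x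
    using Y [OF triple_parity_subset, of x] that unfolding S_def by auto
  have low: "c \<in> S (sym_diff x d) \<longleftrightarrow> (c \<in> S x) \<noteq> (c \<in> d)" if "?g (sym_diff x d) = ?g x" for c x d
    unfolding S_def that by auto
  have gen: "\<exists>t < \<alpha>. c = k + t \<and> {3 * t} \<subseteq> {..<k}" if "c \<in> {k..<k + \<alpha>}" for c
    using that k by (intro exI [of _ "c - k"]) auto
  have one_low: "4 * card {x \<in> Pow {..<k}. (a \<in> S x) = p \<and> (c \<in> S x) = q} = card (Pow {..<k})"
    if ac: "a < k" "c < k + \<alpha>" "a \<noteq> c" for a c p q
  proof -
    obtain d where d: "d \<subseteq> {..<k}" "a \<in> d" "c \<notin> d" "\<And>x. ?g (sym_diff x d) = ?g x"
      using triple_parity_flip [of a k c \<alpha>] ac k by metis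
    \<comment> \<open>For low \<open>c\<close> a parity-preserving flip serves. For high
      \<open>c\<close> a generator does; it changes the vector chosen by \<open>u\<close> and
      perhaps the bit at \<open>a\<close>, but the second flip has to control \<open>c\<close>
      only.\<close>
    have "\<exists>e. e \<subseteq> {..<k} \<and> (\<forall>x \<in> Pow {..<k}. (c \<in> S (sym_diff x e)) = (c \<notin> S x))"
    proof (cases "c < k")
      case True
      then obtain e where "e \<subseteq> {..<k}" "c \<in> e" "\<And>x. ?g (sym_diff x e) = ?g x"
        using triple_parity_flip [of c k a \<alpha>] ac k by metis
      then show ?thesis using low by (intro exI [of _ e]) blast
    next
      case False
      with ac obtain t where t: "t < \<alpha>" "c = k + t" "{3 * t} \<subseteq> {..<k}"
        using gen [of c] by auto
      have "(c \<in> S (sym_diff x {3 * t})) = (c \<notin> S x)" if x: "x \<in> Pow {..<k}" for x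
      proof -
        have "sym_diff x {3 * t} \<in> Pow {..<k}" using x t by auto
        then show ?thesis
          using high [of c x] high [of c "sym_diff x {3 * t}"] x t
          by (simp add: triple_parity_generator)
      qed
      then show ?thesis using t by blast
    qed
    then obtain e where e: "e \<subseteq> {..<k}" "\<And>x. x \<in> Pow {..<k} \<Longrightarrow> (c \<in> S (sym_diff x e)) = (c \<notin> S x)"
      by blast
    show ?thesis
      by (rule card_quarter_by_flips [OF fin bij_betw_sym_diff_Pow [OF d(1)] _ _
            bij_betw_sym_diff_Pow [OF e(1)]])
         (simp_all only: low [OF d(4)] d(2,3) e(2) simp_thms)
  qed
  have both_high: "4 * card {x \<in> Pow {..<k}. (a \<in> S x) = p \<and> (c \<in> S x) = q} = card (Pow {..<k})"
    if ac: "a \<in> {k..<k + \<alpha>}" "c \<in> {k..<k + \<alpha>}" "a \<noteq> c" for a c p q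
  proof -
    obtain s t where s: "s < \<alpha>" "a = k + s" "{3 * s} \<subseteq> {..<k}"
      and t: "t < \<alpha>" "c = k + t" "{3 * t} \<subseteq> {..<k}"
      using gen ac by metis
    \<comment> \<open>Adding \<open>3 * r\<close> moves the high part in the single coordinate
      \<open>k + r\<close>, so the flips for \<open>a\<close> and \<open>c\<close> act
      separately.\<close>
    have step: "(e \<in> S (sym_diff x {3 * r})) = ((e \<in> S x) \<noteq> (e = k + r))"
      if "x \<in> Pow {..<k}" "r < \<alpha>" "{3 * r} \<subseteq> {..<k}" "e \<in> {k..<k + \<alpha>}" for e x r
    proof -
      have "sym_diff x {3 * r} \<in> Pow {..<k}" using that by auto
      then show ?thesis
        using high [of e x] high [of e "sym_diff x {3 * r}"] that
        by (auto simp: triple_parity_generator)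
    qed
    show ?thesis
      by (rule card_quarter_by_flips [OF fin bij_betw_sym_diff_Pow [OF s(3)] _ _
            bij_betw_sym_diff_Pow [OF t(3)]])
         (simp_all only: step [OF _ s(1,3) ac(1)] step [OF _ s(1,3) ac(2)] step [OF _ t(1,3) ac(2)]
            s(2) [symmetric] t(2) [symmetric] ac(3) ac(3) [symmetric] simp_thms)
  qed
  show ?thesis
    unfolding strength2_def S_def [symmetric]
  proof (intro allI impI)
    fix a c p q assume ac: "a < k + \<alpha>" "c < k + \<alpha>" "a \<noteq> c"
    consider "a < k" | "c < k" | "a \<in> {k..<k + \<alpha>}" "c \<in> {k..<k + \<alpha>}"
      using ac by fastforce
    then show "4 * card {x \<in> Pow {..<k}. (a \<in> S x) = p \<and> (c \<in> S x) = q} = card (Pow {..<k})"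
    proof cases
      case 2
      then show ?thesis using one_low [of c a q p] ac by (simp add: conj_commute)
    qed (rule one_low both_high; use ac in simp)+
  qed
qed

section \<open>Fibre permutations and assembly of the design\<close>

text \<open>All fibres over \<open>W\<close> have \<open>b\<close> elements, so each is matched with
  the fibre over its image under \<open>\<sigma>\<close>. Injectivity of \<open>\<sigma>\<close>
  keeps the pieces apart, and finiteness gives surjectivity.\<close>

lemma fibre_permutation:
  assumes "finite I" and s: "\<And>i. i \<in> I \<Longrightarrow> f i \<in> W" "\<sigma> ` W \<subseteq> W" "inj_on \<sigma> W"
    and card: "\<And>w. w \<in> W \<Longrightarrow> card {i \<in> I. f i = w} = b"
  obtains \<rho> where "bij_betw \<rho> I I" "\<And>i. i \<in> I \<Longrightarrow> f (\<rho> i) = \<sigma> (f i)"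
proof -
  have "\<forall>w \<in> W. \<exists>h. bij_betw h {i \<in> I. f i = w} {i \<in> I. f i = \<sigma> w}"
    using s card \<open>finite I\<close>
    by (intro ballI finite_same_card_bij) (auto simp: image_subset_iff)
  then obtain h where h: "\<And>w. w \<in> W \<Longrightarrow> bij_betw (h w) {i \<in> I. f i = w} {i \<in> I. f i = \<sigma> w}"
    by metis
  define \<rho> where "\<rho> i = h (f i) i" for i
  have \<rho>: "\<rho> i \<in> I" "f (\<rho> i) = \<sigma> (f i)" if "i \<in> I" for i
    using h [OF s(1), OF that] that unfolding \<rho>_def bij_betw_def by auto
  have "inj_on \<rho> I"
  proof (rule inj_onI)
    fix i j assume ij: "i \<in> I" "j \<in> I" "\<rho> i = \<rho> j"
    then have "\<sigma> (f i) = \<sigma> (f j)" using \<rho> by metis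
    then have "f i = f j" using ij s by (meson inj_onD)
    then show "i = j"
      using ij h [OF s(1), OF ij(1)] unfolding \<rho>_def bij_betw_def inj_on_def by auto
  qed
  moreover have "\<rho> ` I \<subseteq> I" using \<rho> by auto
  ultimately have "bij_betw \<rho> I I"
    using \<open>finite I\<close> by (simp add: bij_betw_def endo_inj_surj)
  then show ?thesis using that \<rho> by blast
qed

lemma row_column_design_from_array:
  assumes R: "strength2 {..<m} (k + \<alpha>) R" "\<And>i. i < m \<Longrightarrow> R i \<subseteq> {..<k + \<alpha>}"
    and unif: "\<And>w. w \<subseteq> {k..<k + \<alpha>} \<Longrightarrow> card {i \<in> {..<m}. R i \<inter> {k..<k + \<alpha>} = w} = b"
    and m: "m = 2 ^ \<alpha> * b" and k: "3 * \<alpha> \<le> k" "2 \<le> k + \<alpha>"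
  shows "\<exists>D. row_column_design (k + \<alpha>) m (2 ^ k) 2 2 D"
proof -
  let ?K = "{k..<k + \<alpha>}" and ?N = "k + \<alpha>" and ?g = "triple_parity k \<alpha>"
  have "\<exists>\<rho>. bij_betw \<rho> {..<m} {..<m} \<and> (\<forall>i<m. R (\<rho> i) \<inter> ?K = sym_diff (R i \<inter> ?K) v)"
    if v: "v \<subseteq> ?K" for v
  proof -
    have "(\<lambda>w. sym_diff w v) ` Pow ?K \<subseteq> Pow ?K" "inj_on (\<lambda>w. sym_diff w v) (Pow ?K)"
      using bij_betw_sym_diff_Pow [OF v] by (auto simp: bij_betw_def)
    then obtain \<rho> where "bij_betw \<rho> {..<m} {..<m}"
      "\<And>i. i \<in> {..<m} \<Longrightarrow> R (\<rho> i) \<inter> ?K = sym_diff (R i \<inter> ?K) v"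
      using fibre_permutation [of "{..<m}" "\<lambda>i. R i \<inter> ?K" "Pow ?K" "\<lambda>w. sym_diff w v" b] unif
      by auto
    then show ?thesis by auto
  qed
  then obtain \<rho> where \<rho>: "\<And>v. v \<subseteq> ?K \<Longrightarrow> bij_betw (\<rho> v) {..<m} {..<m}"
    and \<rho>_high: "\<And>v i. v \<subseteq> ?K \<Longrightarrow> i < m \<Longrightarrow> R (\<rho> v i) \<inter> ?K = sym_diff (R i \<inter> ?K) v"
    by metis
  have \<rho>_lt: "\<rho> v i < m" if "v \<subseteq> ?K" "i < m" for v i
    using \<rho> [OF that(1)] that(2) bij_betwE by blast
  define F where "F i x = sym_diff x (R (\<rho> (?g x) i))" for i x
  have "card {..<2 ^ k :: nat} = card (Pow {..<k})" by (simp add: card_Pow)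
  from finite_same_card_bij [OF _ _ this]
  obtain X :: "nat \<Rightarrow> nat set" where X: "bij_betw X {..<2 ^ k} (Pow {..<k})"
    by auto
  have X_low: "X j \<subseteq> {..<k}" if "j < 2 ^ k" for j
    using X that bij_betwE by blast
  have F_sub: "F i x \<subseteq> {..<?N}" if "i < m" "x \<subseteq> {..<k}" for i x
    using R(2) [OF \<rho>_lt [OF triple_parity_subset that(1), of x]] that(2) unfolding F_def by auto
  have F_high: "F i x \<inter> ?K = sym_diff (R i \<inter> ?K) (?g x)" if "i < m" "x \<subseteq> {..<k}" for i x
  proof -
    have "x \<inter> ?K = {}" using that(2) by auto
    then have "F i x \<inter> ?K = R (\<rho> (?g x) i) \<inter> ?K" unfolding F_def by blast
    then show ?thesis using \<rho>_high [OF triple_parity_subset that(1)] by simp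
  qed
  define D where "D = mat m (2 ^ k) (\<lambda>(i, j). bit_vec ?N (F i (X j)))"
  have "row_column_design ?N m (2 ^ k) 2 2 D"
    unfolding row_column_design_def
  proof (intro conjI ballI allI impI)
    show "D \<in> carrier_mat m (2 ^ k)" by (simp add: D_def)
    show "elements_mat D \<subseteq> level_vecs 2 ?N" by (auto simp: elements_mat_def D_def)
  next
    fix i assume i: "i < m"
    have "mat_of_rows ?N (list_of_vec (row D i)) = mat (2 ^ k) ?N (\<lambda>(j, t). of_bool (t \<in> F i (X j)))"
      using i by (intro eq_matI) (auto simp: D_def mat_of_rows_def list_of_vec_index)
    \<comment> \<open>With \<open>i\<close> fixed, \<open>R (\<rho> v i)\<close> takes the role of
      \<open>u v\<close> and the high part of \<open>R i\<close> that of \<open>y\<close>.\<close>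
    moreover have "strength2 (Pow {..<k}) ?N (F i)"
      unfolding F_def using strength2_twisted_coset [of \<alpha> k "\<lambda>v. R (\<rho> v i)", OF k(1) \<rho>_high [OF _ i]]
      by blast
    ultimately show "orthogonal_array (2 ^ k) ?N 2 2 (mat_of_rows ?N (list_of_vec (row D i)))"
      using strength2_orthogonal_array [OF strength2_reindex [OF _ X] k(2)] by simp
  next
    fix j :: nat assume j: "j < 2 ^ k"
    have "mat_of_rows ?N (list_of_vec (col D j)) = mat m ?N (\<lambda>(i, t). of_bool (t \<in> F i (X j)))"
      using j by (intro eq_matI) (auto simp: D_def mat_of_rows_def list_of_vec_index)
    moreover have "strength2 {..<m} ?N (\<lambda>i. F i (X j))"
      unfolding F_def
      by (intro strength2_sym_diff strength2_reindex [OF R(1)] \<rho> triple_parity_subset)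
    ultimately show "orthogonal_array m ?N 2 2 (mat_of_rows ?N (list_of_vec (col D j)))"
      using strength2_orthogonal_array [OF _ k(2)] by simp
  next
    fix v assume "v \<in> level_vecs 2 ?N"
    then obtain S where S: "S \<subseteq> {..<?N}" "v = bit_vec ?N S" by (rule level_vecs_2E)
    let ?J = "{i \<in> {..<m}. R i \<inter> ?K = S \<inter> ?K}"
    let ?P = "{(i, j). i < m \<and> j < 2 ^ k \<and> D $$ (i, j) = v}"
    have P: "(i, j) \<in> ?P \<longleftrightarrow> i < m \<and> j < 2 ^ k \<and> F i (X j) = S" for i j
      using F_sub [OF _ X_low] S by (auto simp: D_def bit_vec_eq_iff)
    \<comment> \<open>A cell has entry \<open>S\<close> iff \<open>X j\<close> is the sum of
      \<open>S\<close> and \<open>R r\<close> with \<open>r = \<rho> (?g (X j)) i\<close>. As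
      \<open>X j\<close> has no high coordinates, \<open>r\<close> lies in \<open>?J\<close>;
      conversely \<open>r\<close> determines first the column and then \<open>i\<close>.\<close>
    have "bij_betw (\<lambda>(i, j). \<rho> (?g (X j)) i) ?P ?J"
      unfolding bij_betw_def
    proof
      show "inj_on (\<lambda>(i, j). \<rho> (?g (X j)) i) ?P"
      proof (rule inj_onI, clarsimp simp only: P prod.case split_paired_all)
        fix i j i' j'
        assume ij: "i < m" "j < 2 ^ k" "i' < m" "j' < 2 ^ k"
          and eq: "\<rho> (?g (X j)) i = \<rho> (?g (X j')) i'" and F: "F i' (X j') = F i (X j)"
        \<comment> \<open>Equal entries built from the same row of \<open>R\<close> have the same
          translating set.\<close>
        then have "X j = X j'" unfolding F_def by auto
        then have "j = j'" using X ij unfolding bij_betw_def inj_on_def by auto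
        moreover have "i = i'"
          using \<rho> [OF triple_parity_subset, of "X j"] eq ij \<open>X j = X j'\<close>
          unfolding bij_betw_def inj_on_def by auto
        ultimately show "i = i' \<and> j = j'" by simp
      qed
      show "(\<lambda>(i, j). \<rho> (?g (X j)) i) ` ?P = ?J"
      proof (intro equalityI subsetI)
        fix r assume "r \<in> (\<lambda>(i, j). \<rho> (?g (X j)) i) ` ?P"
        then obtain i j where P_ij: "(i, j) \<in> ?P" and r: "r = \<rho> (?g (X j)) i"
          by (elim imageE) (simp only: split_paired_all prod.case that)
        from P_ij have ij: "i < m" "j < 2 ^ k" "F i (X j) = S" unfolding P by auto
        have "r < m" unfolding r using \<rho>_lt [OF triple_parity_subset] ij by blast
        moreover have "R r \<inter> ?K = S \<inter> ?K"
          using F_high [OF ij(1) X_low [OF ij(2)]] \<rho>_high [OF triple_parity_subset ij(1)] ij(3)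
          unfolding r by simp
        ultimately show "r \<in> ?J" by simp
      next
        fix r assume r: "r \<in> ?J"
        \<comment> \<open>The high parts of \<open>S\<close> and \<open>R r\<close> cancel, so
          \<open>x\<close> names a column.\<close>
        define x where "x = sym_diff S (R r)"
        have "x \<subseteq> {..<k}"
        proof
          fix t assume t: "t \<in> x"
          then have "t < ?N" using S(1) R(2) [of r] r unfolding x_def by auto
          moreover have "t \<notin> ?K" using t r unfolding x_def by blast
          ultimately show "t \<in> {..<k}" by auto
        qed
        then obtain j where j: "j < 2 ^ k" "X j = x"
          using X unfolding bij_betw_def by (metis PowI imageE lessThan_iff)
        obtain i where i: "i < m" "\<rho> (?g x) i = r"
          using \<rho> [OF triple_parity_subset, of x] r unfolding bij_betw_def
          by (metis (no_types, lifting) imageE lessThan_iff mem_Collect_eq)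
        have "F i (X j) = S" unfolding F_def j i unfolding x_def by auto
        then have "(i, j) \<in> ?P" unfolding P using i j by simp
        then show "r \<in> (\<lambda>(i, j). \<rho> (?g (X j)) i) ` ?P" using i j by force
      qed
    qed
    then have "card ?P = card ?J" by (rule bij_betw_same_card)
    also have "\<dots> = b" by (intro unif) auto
    finally show "card ?P * 2 ^ ?N = m * 2 ^ k"
      by (simp add: m power_add)
  qed (use k in auto)
  then show ?thesis by blast
qed

section \<open>Sign arrays from Hadamard matrices\<close>

text \<open>Normalising by the first row of the Hadamard matrix, rather than by its first column, makes the
  orthogonality of the rows sufficient.\<close>

lemma hadamard_normalised:
  assumes "hadamard_matrix n H" "0 < n"
  obtains B :: "nat \<Rightarrow> nat \<Rightarrow> int"
  where "\<And>i a. B i a \<in> {1, -1}" "\<And>i. B i 0 = 1"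
    "\<And>a c. a < n \<Longrightarrow> c < n \<Longrightarrow> a \<noteq> c \<Longrightarrow> (\<Sum>i<n. B i a * B i c) = 0"
proof -
  \<comment> \<open>Column \<open>i\<close> of \<open>H\<close> is scaled by its top entry, and the
    indices are transposed: \<open>i\<close> becomes a row of the array. The value 1 outside the
    matrix makes the facts on signs and on column 0 unconditional.\<close>
  define B where "B i a = (if i < n \<and> a < n then H $$ (0, i) * H $$ (a, i) else 1)" for i a
  have H: "H \<in> carrier_mat n n" and orth: "H * transpose_mat H = int n \<cdot>\<^sub>m 1\<^sub>m n"
    using assms by (auto simp: hadamard_matrix_def)
  have pm: "H $$ (a, i) = 1 \<or> H $$ (a, i) = -1" if "a < n" "i < n" for a i
    using assms that unfolding hadamard_matrix_def elements_mat_def by fastforce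
  have sq: "H $$ (a, i) * H $$ (a, i) = 1" if "a < n" "i < n" for a i
    using pm [OF that] by auto
  show ?thesis
  proof
    show "B i a \<in> {1, -1}" for i a
      using pm [of a i] pm [of 0 i] by (auto simp: B_def)
    show "B i 0 = 1" for i
      using sq [of 0 i] by (simp add: B_def)
    fix a c assume ac: "a < n" "c < n" "a \<noteq> c"
    have "(\<Sum>i<n. B i a * B i c) = (\<Sum>i<n. H $$ (a, i) * H $$ (c, i))"
    proof (rule sum.cong)
      fix i assume "i \<in> {..<n}"
      then have "B i a * B i c = (H $$ (0, i) * H $$ (0, i)) * (H $$ (a, i) * H $$ (c, i))"
        using ac by (simp add: B_def)
      then show "B i a * B i c = H $$ (a, i) * H $$ (c, i)"
        using sq [of 0 i] \<open>i \<in> {..<n}\<close> by simp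
    qed simp
    also have "\<dots> = (H * transpose_mat H) $$ (a, c)"
      using H ac by (simp add: scalar_prod_def lessThan_atLeast0)
    also have "\<dots> = 0" using ac by (simp add: orth)
    finally show "(\<Sum>i<n. B i a * B i c) = 0" .
  qed
qed

text \<open>Four times the indicator of a prescribed pair of signs \<open>s\<close>,
  \<open>t\<close> is \<open>(1 + s * f i) * (1 + t * g i)\<close>. In the sum only the constant
  term survives.\<close>

lemma orthogonal_signs_quarter:
  fixes f g :: "'i \<Rightarrow> int"
  assumes "finite I" "\<And>i. i \<in> I \<Longrightarrow> f i \<in> {1, -1}" "\<And>i. i \<in> I \<Longrightarrow> g i \<in> {1, -1}"
    and "sum f I = 0" "sum g I = 0" "(\<Sum>i\<in>I. f i * g i) = 0"
  shows "4 * card {i \<in> I. (f i = -1) = p \<and> (g i = -1) = q} = card I"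
proof -
  define s t :: int where "s = (if p then -1 else 1)" and "t = (if q then -1 else 1)"
  have "int (4 * card {i \<in> I. (f i = -1) = p \<and> (g i = -1) = q}) =
      (\<Sum>i\<in>I. 4 * of_bool ((f i = -1) = p \<and> (g i = -1) = q))"
    using \<open>finite I\<close> by (simp flip: sum_distrib_left add: sum.If_cases of_bool_def Int_def)
  also have "\<dots> = (\<Sum>i\<in>I. (1 + s * f i) * (1 + t * g i))"
  proof (rule sum.cong)
    fix i assume "i \<in> I"
    then show "4 * of_bool ((f i = -1) = p \<and> (g i = -1) = q) = (1 + s * f i) * (1 + t * g i)"
      using assms(2,3) [of i] unfolding s_def t_def by (cases p; cases q) auto
  qed simp
  also have "\<dots> = (\<Sum>i\<in>I. 1 + s * f i + t * g i + (s * t) * (f i * g i))"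
    by (simp add: algebra_simps)
  also have "\<dots> = int (card I)"
    using assms(4-6) by (simp add: sum.distrib flip: sum_distrib_left)
  finally show ?thesis by linarith
qed

lemma sum_lessThan_double:
  "(\<Sum>i<2 * n. f i) = (\<Sum>i<n. f i) + (\<Sum>i<n. f (n + i :: nat))"
  for f :: "nat \<Rightarrow> int"
  using sum.atLeastLessThan_concat [of 0 n "n + n" f] sum.shift_bounds_nat_ivl [of f 0 n n]
  by (simp add: lessThan_atLeast0 mult_2 add.commute)

text \<open>Each step is the Kronecker product with the Hadamard matrix of order 2.\<close>

lemma hadamard_doubling:
  assumes "hadamard_matrix (4 * b) H" "0 < b" "N = 2 ^ r * (4 * b)"
  shows "\<exists>(B :: nat \<Rightarrow> nat \<Rightarrow> int) l.
    (\<forall>i a. B i a \<in> {1, -1}) \<and> (\<forall>i. B i 0 = 1) \<and>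
    (\<forall>a<N. \<forall>c<N. a \<noteq> c \<longrightarrow> (\<Sum>i<N. B i a * B i c) = 0) \<and>
    inj_on l {..<r + 2} \<and> l ` {..<r + 2} \<subseteq> {1..<N} \<and>
    (\<forall>w \<subseteq> {..<r + 2}. card {i \<in> {..<N}. {t \<in> {..<r + 2}. B i (l t) = -1} = w} = b)"
  using assms(3)
proof (induction r arbitrary: N)
  case 0
  then have N: "N = 4 * b" by simp
  then obtain B :: "nat \<Rightarrow> nat \<Rightarrow> int"
    where B: "\<And>i a. B i a \<in> {1, -1}" "\<And>i. B i 0 = 1"
      "\<And>a c. a < N \<Longrightarrow> c < N \<Longrightarrow> a \<noteq> c \<Longrightarrow> (\<Sum>i<N. B i a * B i c) = 0"
    using hadamard_normalised [OF assms(1)] assms(2) by auto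
  \<comment> \<open>Orthogonality to the constant column 0 balances columns 1 and 2; being
    orthogonal to each other, they show each pattern in a quarter of the \<open>4 * b\<close>
    rows.\<close>
  have "card {i \<in> {..<N}. {t \<in> {..<2}. B i (Suc t) = -1} = w} = b" if "w \<subseteq> {..<2}" for w
  proof -
    have "{t \<in> {..<2}. B i (Suc t) = -1} = w \<longleftrightarrow>
        (\<forall>t<2. (B i (Suc t) = -1) = (t \<in> w))" for i
      using that by blast
    then have "{t \<in> {..<2}. B i (Suc t) = -1} = w \<longleftrightarrow>
        (B i 1 = -1) = (0 \<in> w) \<and> (B i 2 = -1) = (1 \<in> w)" for i
      by (simp add: All_less_Suc2 numeral_2_eq_2)
    then show ?thesis
      using orthogonal_signs_quarter [of "{..<N}" "\<lambda>i. B i 1" "\<lambda>i. B i 2" "0 \<in> w" "1 \<in> w"]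
        B(1) B(3) [of 0 1] B(3) [of 0 2] B(3) [of 1 2] assms(2) N by (simp add: B(2))
  qed
  then show ?case
    unfolding add_0 using B assms(2) N by (intro exI [of _ B] exI [of _ Suc]) auto
next
  case (Suc r)
  define M where "M = 2 ^ r * (4 * b)"
  have N: "N = 2 * M" and "0 < M" using Suc.prems assms(2) by (auto simp: M_def)
  obtain B :: "nat \<Rightarrow> nat \<Rightarrow> int" and l
    where B: "\<And>i a. B i a \<in> {1, -1}" "\<And>i. B i 0 = 1"
      and orth: "\<And>a c. a < M \<Longrightarrow> c < M \<Longrightarrow> a \<noteq> c \<Longrightarrow> (\<Sum>i<M. B i a * B i c) = 0"
      and l: "inj_on l {..<r + 2}" "l ` {..<r + 2} \<subseteq> {1..<M}"
      and unif: "\<And>w. w \<subseteq> {..<r + 2} \<Longrightarrow>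
        card {i \<in> {..<M}. {t \<in> {..<r + 2}. B i (l t) = -1} = w} = b"
    using Suc.IH [OF M_def] by blast
  \<comment> \<open>The extra sign is the entry of the order-2 Hadamard matrix for the halves
    containing \<open>i\<close> and \<open>a\<close>.\<close>
  define B' where "B' i a = B (i mod M) (a mod M) * (if M \<le> i \<and> M \<le> a then -1 else 1)" for i a
  \<comment> \<open>Column \<open>M\<close> is constant on each half and tells the halves apart. As
    a new distinguished column it doubles the patterns along with the rows, so each still occurs
    \<open>b\<close> times.\<close>
  define l' where "l' = l(r + 2 := M)"
  define T where "T i = {t \<in> {..<r + 2}. B i (l t) = -1}" for i
  define T' where "T' i = {t \<in> {..<Suc r + 2}. B' i (l' t) = -1}" for i
  have B'_low: "B' i a = B i (a mod M)" if "i < M" for i a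
    using that by (simp add: B'_def)
  have B'_high: "B' (M + i) a = B i (a mod M) * (if M \<le> a then -1 else 1)" if "i < M" for i a
    using that by (simp add: B'_def)
  have l_lt: "1 \<le> l t" "l t < M" if "t < r + 2" for t
    using l(2) that by auto
  have T'_low: "T' i = T i" if "i < M" for i
    unfolding T_def T'_def using that l_lt
    by (auto simp: B'_low l'_def B(2) less_Suc_eq)
  have T'_high: "T' (M + i) = insert (r + 2) (T i)" if "i < M" for i
  proof (rule Set.set_eqI)
    fix t
    consider "t < r + 2" | "t = r + 2" | "r + 2 < t" by linarith
    then show "t \<in> T' (M + i) \<longleftrightarrow> t \<in> insert (r + 2) (T i)"
    proof cases
      case 1
      then show ?thesis
        using that l_lt [OF 1] by (simp add: T_def T'_def B'_high l'_def)
    qed (use that in \<open>simp_all add: T_def T'_def B'_high l'_def B(2)\<close>)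
  qed
  show ?case
  proof (intro exI conjI allI impI)
    show "B' i a \<in> {1, -1}" for i a
      using B(1) [of "i mod M" "a mod M"] by (auto simp: B'_def)
    show "B' i 0 = 1" for i
      using \<open>0 < M\<close> by (simp add: B'_def B(2))
  next
    fix a c assume ac: "a < N" "c < N" "a \<noteq> c"
    let ?s = "\<lambda>a. (if M \<le> a then -1 else 1) :: int"
    have "(\<Sum>i<N. B' i a * B' i c) =
        (\<Sum>i<M. B i (a mod M) * B i (c mod M)) +
        (\<Sum>i<M. (?s a * ?s c) * (B i (a mod M) * B i (c mod M)))"
      unfolding N sum_lessThan_double
      by (intro arg_cong2 [where f = plus] sum.cong refl) (simp_all add: B'_low B'_high)
    also have "\<dots> = (1 + ?s a * ?s c) * (\<Sum>i<M. B i (a mod M) * B i (c mod M))"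
      by (simp only: flip: sum_distrib_left) (simp add: algebra_simps)
    also have "\<dots> = 0"
    \<comment> \<open>If the residues agree, \<open>a\<close> and \<open>c\<close> lie in different
      halves and the sign factor is 0; otherwise the sum vanishes by the induction
      hypothesis.\<close>
    proof (cases "a mod M = c mod M")
      case True
      have "a div M < 2" "c div M < 2"
        using ac by (simp_all add: N less_mult_imp_div_less)
      moreover have "a div M \<noteq> c div M" using True ac by (metis div_mult_mod_eq)
      ultimately have "(a div M = 0) \<noteq> (c div M = 0)" by linarith
      then have "(a < M) \<noteq> (c < M)" using \<open>0 < M\<close> by (simp add: div_eq_0_iff)
      then show ?thesis by auto
    next
      case False
      then show ?thesis using orth [of "a mod M" "c mod M"] \<open>0 < M\<close> by simp
    qed
    finally show "(\<Sum>i<N. B' i a * B' i c) = 0" .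
  next
    have "{..<Suc r + 2} = insert (r + 2) {..<r + 2}" by auto
    moreover have "M \<notin> l ` {..<r + 2}" using l(2) by auto
    ultimately show "inj_on l' {..<Suc r + 2}"
      using l(1) unfolding l'_def by (auto simp: inj_on_def)
    show "l' ` {..<Suc r + 2} \<subseteq> {1..<N}"
      using l_lt \<open>0 < M\<close> by (force simp: l'_def N less_Suc_eq)
  next
    fix w assume w: "w \<subseteq> {..<Suc r + 2}"
    \<comment> \<open>Membership of \<open>r + 2\<close> in \<open>w\<close> decides which half
      contains the matching rows.\<close>
    let ?h = "\<lambda>i. if r + 2 \<in> w then M + i else i"
    have "r + 2 \<notin> T i" for i by (simp add: T_def)
    then have T'_eq: "T' i = w \<longleftrightarrow> r + 2 \<notin> w \<and> T i = w - {r + 2}"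
      "T' (M + i) = w \<longleftrightarrow> r + 2 \<in> w \<and> T i = w - {r + 2}" if "i < M" for i
      using T'_low [OF that] T'_high [OF that] by auto
    have "{i \<in> {..<N}. T' i = w} = ?h ` {i \<in> {..<M}. T i = w - {r + 2}}"
    proof (intro equalityI subsetI)
      fix i assume i: "i \<in> {i \<in> {..<N}. T' i = w}"
      show "i \<in> ?h ` {i \<in> {..<M}. T i = w - {r + 2}}"
      proof (cases "i < M")
        case True
        then show ?thesis using i T'_eq(1) [of i] by (intro image_eqI [of _ _ i]) auto
      next
        case False
        then obtain j where "i = M + j" "j < M"
          using i by (intro that [of "i - M"]) (auto simp: N)
        then show ?thesis using i T'_eq(2) [of j] by (intro image_eqI [of _ _ j]) auto
      qed
    next
      fix i assume "i \<in> ?h ` {i \<in> {..<M}. T i = w - {r + 2}}"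
      then show "i \<in> {i \<in> {..<N}. T' i = w}"
        using T'_eq by (auto simp: N split: if_splits)
    qed
    then have "card {i \<in> {..<N}. T' i = w} = card {i \<in> {..<M}. T i = w - {r + 2}}"
      by (simp only:) (intro card_image, auto simp: inj_on_def)
    moreover have "w - {r + 2} \<subseteq> {..<r + 2}" using w by auto
    ultimately show "card {i \<in> {..<N}. {t \<in> {..<Suc r + 2}. B' i (l' t) = -1} = w} = b"
      using unif unfolding T_def T'_def by simp
  qed
qed

section \<open>Choice of coordinates among the sign columns\<close>

theorem theorem7:
  fixes b \<alpha> k :: nat
  assumes "b \<ge> 1"
    and "\<exists>H. hadamard_matrix (4 * b) H"
    and "\<alpha> \<ge> 2"
    and "2 ^ \<alpha> + \<alpha> + 1 \<le> k"
    and "k < 2 ^ \<alpha> * b - \<alpha>"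
  shows "\<exists>D. row_column_design (k + \<alpha>) (2 ^ \<alpha> * b) (2 ^ k) 2 2 D"
proof -
  define N where "N = 2 ^ \<alpha> * b"
  obtain H where H: "hadamard_matrix (4 * b) H" using assms(2) by blast
  \<comment> \<open>Doubling starts from order \<open>4 * b\<close> with two distinguished columns;
    \<open>\<alpha> - 2\<close> steps reach order \<open>N\<close> with \<open>\<alpha>\<close> of
    them.\<close>
  have \<alpha>: "\<alpha> - 2 + 2 = \<alpha>" using assms(3) by simp
  then have N: "N = 2 ^ (\<alpha> - 2) * (4 * b)"
    unfolding N_def using power_add [of "2 :: nat" "\<alpha> - 2" 2] by simp
  have "0 < b" using assms(1) by simp
  obtain B :: "nat \<Rightarrow> nat \<Rightarrow> int" and l
    where B: "\<And>i a. B i a \<in> {1, -1}" "\<And>i. B i 0 = 1"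
      and orth: "\<And>a c. a < N \<Longrightarrow> c < N \<Longrightarrow> a \<noteq> c \<Longrightarrow> (\<Sum>i<N. B i a * B i c) = 0"
      and l: "inj_on l {..<\<alpha>}" "l ` {..<\<alpha>} \<subseteq> {1..<N}"
      and unif: "\<And>w. w \<subseteq> {..<\<alpha>} \<Longrightarrow> card {i \<in> {..<N}. {t \<in> {..<\<alpha>}. B i (l t) = -1} = w} = b"
    using hadamard_doubling [OF H \<open>0 < b\<close> N, unfolded \<alpha>] by blast
  \<comment> \<open>Column 0 is constant and the columns in the range of \<open>l\<close> are
    reserved for the high coordinates; the upper bound on \<open>k\<close> says that
    \<open>k\<close> columns remain.\<close>
  have "card ({1..<N} - l ` {..<\<alpha>}) = N - 1 - \<alpha>"
    using l by (simp add: card_Diff_subset card_image)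
  then have "card {..<k} \<le> card ({1..<N} - l ` {..<\<alpha>})"
    using assms(5) by (simp add: N_def)
  then obtain e where e: "inj_on e {..<k}" "e ` {..<k} \<subseteq> {1..<N} - l ` {..<\<alpha>}"
    using card_le_inj [of "{..<k}" "{1..<N} - l ` {..<\<alpha>}"] by auto
  define \<phi> where "\<phi> t = (if t < k then e t else l (t - k))" for t
  have \<phi>_range: "1 \<le> \<phi> t \<and> \<phi> t < N" if "t < k + \<alpha>" for t
  proof (cases "t < k")
    case True
    then have "e t \<in> {1..<N}" using e(2) by auto
    then show ?thesis using True by (simp add: \<phi>_def)
  next
    case False
    then have "t - k \<in> {..<\<alpha>}" using that by auto
    then have "l (t - k) \<in> {1..<N}" using l(2) by blast
    then show ?thesis using False by (simp add: \<phi>_def)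
  qed
  have \<phi>_inj: "\<phi> s \<noteq> \<phi> t" if "s < t" "t < k + \<alpha>" for s t
  proof -
    consider "t < k" | "s < k" "k \<le> t" | "k \<le> s" by linarith
    then show ?thesis
    proof cases
      case 1
      then show ?thesis using e(1) that by (auto simp: \<phi>_def dest: inj_onD)
    next
      case 2
      then have "s \<in> {..<k}" "t - k \<in> {..<\<alpha>}" using that by auto
      then have "e s \<in> {1..<N} - l ` {..<\<alpha>}" "l (t - k) \<in> l ` {..<\<alpha>}"
        using e(2) by blast+
      then show ?thesis using 2 by (auto simp: \<phi>_def)
    next
      case 3
      then have "s - k \<in> {..<\<alpha>}" "t - k \<in> {..<\<alpha>}" "s - k \<noteq> t - k" using that by auto
      then have "l (s - k) \<noteq> l (t - k)" using inj_onD [OF l(1)] by blast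
      then show ?thesis using 3 that by (simp add: \<phi>_def)
    qed
  qed
  define R where "R i = {t. t < k + \<alpha> \<and> B i (\<phi> t) = -1}" for i
  have "strength2 {..<N} (k + \<alpha>) R"
    unfolding strength2_def
  proof (intro allI impI)
    fix a c p q assume ac: "a < k + \<alpha>" "c < k + \<alpha>" "a \<noteq> c"
    then have "\<phi> a \<noteq> \<phi> c" using \<phi>_inj by (metis linorder_neqE_nat)
    \<comment> \<open>Since \<open>\<phi>\<close> avoids 0, both columns are orthogonal to the
      constant column and hence balanced.\<close>
    then show "4 * card {i \<in> {..<N}. (a \<in> R i) = p \<and> (c \<in> R i) = q} = card {..<N}"
      using orthogonal_signs_quarter [of "{..<N}" "\<lambda>i. B i (\<phi> a)" "\<lambda>i. B i (\<phi> c)" p q]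
        \<phi>_range [OF ac(1)] \<phi>_range [OF ac(2)] ac B(1)
        orth [of 0 "\<phi> a"] orth [of 0 "\<phi> c"] orth [of "\<phi> a" "\<phi> c"]
      by (simp add: R_def B(2))
  qed
  moreover have "R i \<subseteq> {..<k + \<alpha>}" for i by (auto simp: R_def)
  moreover have "card {i \<in> {..<N}. R i \<inter> {k..<k + \<alpha>} = w} = b" if w: "w \<subseteq> {k..<k + \<alpha>}" for w
  proof -
    have "R i \<inter> {k..<k + \<alpha>} = w \<longleftrightarrow> (\<forall>s \<in> (+) k ` {..<\<alpha>}. s \<in> R i \<longleftrightarrow> s \<in> w)" for i
      using w by (auto simp: lessThan_atLeast0)
    then have "R i \<inter> {k..<k + \<alpha>} = w \<longleftrightarrow>
        {t \<in> {..<\<alpha>}. B i (l t) = -1} = {t \<in> {..<\<alpha>}. k + t \<in> w}" for i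
      by (auto simp: R_def \<phi>_def)
    then show ?thesis by (simp only:) (intro unif, auto)
  qed
  moreover have "3 * \<alpha> \<le> k"
  proof -
    \<comment> \<open>At \<open>n = \<alpha> - 2\<close> this reads
      \<open>2 * \<alpha> - 1 \<le> 2 ^ \<alpha>\<close>, so the lower bound on \<open>k\<close>
      leaves room for \<open>\<alpha>\<close> disjoint triples.\<close>
    have "2 * n + 3 \<le> 2 ^ (n + 2)" for n :: nat by (induction n) auto
    from this [of "\<alpha> - 2"] show ?thesis using assms(3,4) unfolding \<alpha> by linarith
  qed
  ultimately have "\<exists>D. row_column_design (k + \<alpha>) N (2 ^ k) 2 2 D"
    by (intro row_column_design_from_array [where R = R and b = b]) (use assms(3) N_def in auto)
  then show ?thesis by (simp only: N_def)
qed

end
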